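(* Let $p$ be a prime and let $t \geq 2$ be an integer. Then $$s_{pt}\left((\mathbb{Z}/p\mathbb{Z})^2\right) = (t+2)p - 2.$$
   Context: A sequence in an abelian group $G$ is a finite list of elements of $G$ (repetitions allowed); a subsequence is obtained by selecting any subset of the positions (not necessarily consecutive). A sequence is zero-sum if its terms sum to $0$ in $G$. For a positive integer $L$, the Erdős–Ginzburg–Ziv constant $s_L(G)$ is the minimal integer $\ell$ such that every sequence of length $\ell$ with elements in $G$ contains a zero-sum subsequence of length $L$. *)

theory Defs
  imports
    "HOL-Algebra.Elementary_Groups"
    "HOL-Algebra.FiniteProduct"
    "HOL-Library.Sublist"
    "HOL-Computational_Algebra.Primes"
begin

text \<open>
  Sequences are lists and subsequences are given by \<^const>\<open>subseq\<close>, so a term may be used as often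
  as it occurs and the chosen positions need not be consecutive.  HOL-Algebra writes abelian groups
  multiplicatively: the sum of a sequence is a \<^const>\<open>finprod\<close> and the zero of \<open>G\<close> is \<open>\<one>\<^bsub>G\<^esub>\<close>.
\<close>

definition zero_sum :: "('a, 'b) monoid_scheme \<Rightarrow> 'a list \<Rightarrow> bool" where
  "zero_sum G xs \<longleftrightarrow> (\<Otimes>\<^bsub>G\<^esub>i\<in>{..<length xs}. xs ! i) = \<one>\<^bsub>G\<^esub>"

text \<open>
  If no length \<open>l\<close> has the required property, then the \<open>LEAST\<close> below is an unspecified number;
  this does not occur for finite \<open>G\<close> and \<open>L\<close> a positive multiple of the exponent of \<open>G\<close>.
\<close>

definition egz_const :: "nat \<Rightarrow> ('a, 'b) monoid_scheme \<Rightarrow> nat" where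
  "egz_const L G =
    (LEAST l. \<forall>xs. set xs \<subseteq> carrier G \<and> length xs = l \<longrightarrow>
       (\<exists>ys. subseq ys xs \<and> length ys = L \<and> zero_sum G ys))"

lemma comm_group_integer_mod_group_square:
  "comm_group (integer_mod_group n \<times>\<times> integer_mod_group n)"
  by (intro group.group_comm_groupI DirProd_group group_integer_mod_group)
    (auto simp: add.commute)

end

theory Submission
  imports Defs "HOL-Number_Theory.Residues"
begin

text \<open>
  Call a function on the subsets of a finite index set \<open>X\<close> of degree at most \<open>d\<close> if it is a
  multilinear polynomial of degree at most \<open>d\<close> in the indicator variables of the elements. If
  \<open>d < |X|\<close>, its sum over all \<open>I \<subseteq> X\<close> with signs \<open>(-1) ^ |I|\<close> is zero. By Fermat's little theorem,
  the indicator modulo \<open>p\<close> of those \<open>I\<close> with zero sum in \<open>(\<int>/p)\<^sup>2\<close> and \<open>p\<close> dividing \<open>|I|\<close> has degree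
  \<open>3 (p - 1)\<close>. Hence \<open>3 p - 2\<close> indices contain a zero-sum set of size \<open>p\<close> or \<open>2 p\<close>.

  Among \<open>4 p - 2\<close> indices there is even one of size \<open>p\<close>: otherwise none has size \<open>3 p\<close> either
  (split off one of size \<open>2 p\<close>), and weighting by \<open>binomial(|I|, p) - 2\<close>, of degree \<open>p\<close>, yields
  \<open>2 = 0\<close> modulo \<open>p\<close>; the prime \<open>2\<close> is handled by the pigeonhole principle. Splitting off zero-sum
  sets of size \<open>p\<close> gives size \<open>t p\<close> by induction on \<open>t\<close>; for \<open>t = 2\<close>, splitting twice a set of size
  \<open>p\<close> or \<open>2 p\<close> suffices. For the lower bound take \<open>t p - 1\<close> zeros and \<open>p - 1\<close> copies
  of each of the two standard generators.
\<close>

section \<open>Bounded-degree functions of a set and their alternating sums\<close>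

text \<open>The rules generate the span of the monomials, so rule induction reduces products and
  alternating sums to monomials. Arguments are arbitrary sets, not only subsets of a fixed
  \<open>X\<close>.\<close>

inductive degree_le :: "nat \<Rightarrow> ('i set \<Rightarrow> int) \<Rightarrow> bool" for d where
  monomial: "finite A \<Longrightarrow> card A \<le> d \<Longrightarrow> degree_le d (\<lambda>I. of_bool (A \<subseteq> I))"
| zero: "degree_le d (\<lambda>I. 0)"
| add_scaled: "degree_le d F \<Longrightarrow> degree_le d G \<Longrightarrow> degree_le d (\<lambda>I. F I + c * G I)"

lemma degree_le_scale:
  assumes "degree_le d F"
  shows "degree_le d (\<lambda>I. c * F I)"
  using degree_le.add_scaled[OF degree_le.zero assms, of c] by simp

lemma degree_le_const: "degree_le d (\<lambda>I. c)"
  using degree_le_scale[OF degree_le.monomial[of "{}" d], of c] by simp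

lemma degree_le_add:
  assumes "degree_le d F" "degree_le d G"
  shows "degree_le d (\<lambda>I. F I + G I)"
  using degree_le.add_scaled[OF assms, of 1] by simp

lemma degree_le_diff:
  assumes "degree_le d F" "degree_le d G"
  shows "degree_le d (\<lambda>I. F I - G I)"
  using degree_le.add_scaled[OF assms, of "-1"] by simp

lemma degree_le_sum:
  assumes "\<And>x. x \<in> S \<Longrightarrow> degree_le d (F x)"
  shows "degree_le d (\<lambda>I. \<Sum>x\<in>S. F x I)"
  using assms
  by (induction S rule: infinite_finite_induct) (auto intro: degree_le.zero degree_le_add)

text \<open>Indicators are idempotent, so the monomials of \<open>A\<close> and \<open>B\<close>
  multiply to that of \<open>A \<union> B\<close>. Bilinearity gives the rest.\<close>

lemma degree_le_mult:
  assumes "degree_le d F" "degree_le e G"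
  shows "degree_le (d + e) (\<lambda>I. F I * G I)"
  using assms(1)
proof (induction rule: degree_le.induct)
  case (monomial A)
  from assms(2) show ?case
  proof (induction rule: degree_le.induct)
    case (monomial B)
    have "card (A \<union> B) \<le> d + e"
      using \<open>card A \<le> d\<close> monomial card_Un_le[of A B] by linarith
    then have "degree_le (d + e) (\<lambda>I. of_bool (A \<union> B \<subseteq> I))"
      using \<open>finite A\<close> monomial by (intro degree_le.monomial) auto
    then show ?case by (simp add: of_bool_conj)
  next
    case zero
    show ?case by (simp add: degree_le.zero)
  next
    case (add_scaled F G c)
    from degree_le.add_scaled[OF add_scaled.IH, of c] show ?case
      by (simp add: algebra_simps)
  qed
next
  case zero
  show ?case by (simp add: degree_le.zero)
next
  case (add_scaled F1 F2 c)
  from degree_le.add_scaled[OF add_scaled.IH, of c] show ?case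
    by (simp add: algebra_simps)
qed

lemma degree_le_power:
  assumes "degree_le d F"
  shows "degree_le (k * d) (\<lambda>I. F I ^ k)"
proof (induction k)
  case 0
  show ?case by (simp add: degree_le_const)
next
  case (Suc k)
  from degree_le_mult[OF assms Suc] show ?case by simp
qed

text \<open>Intersecting with \<open>X\<close> makes this a finite combination of singleton
  monomials for every \<open>I\<close>, and changes nothing for
  \<open>I \<subseteq> X\<close>.\<close>

lemma degree_le_linear:
  assumes "finite X"
  shows "degree_le 1 (\<lambda>I. \<Sum>i\<in>I \<inter> X. a i)"
proof -
  have "(\<lambda>I. \<Sum>i\<in>I \<inter> X. a i) = (\<lambda>I. \<Sum>i\<in>X. a i * of_bool ({i} \<subseteq> I))"
  proof
    fix I
    have "(\<Sum>i\<in>X \<inter> I. a i) = (\<Sum>i\<in>X. a i * of_bool ({i} \<subseteq> I))"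
      unfolding sum.inter_restrict[OF assms] by (intro sum.cong) auto
    then show "(\<Sum>i\<in>I \<inter> X. a i) = (\<Sum>i\<in>X. a i * of_bool ({i} \<subseteq> I))"
      by (simp add: Int_commute)
  qed
  moreover have "degree_le 1 (\<lambda>I. \<Sum>i\<in>X. a i * of_bool ({i} \<subseteq> I))"
    by (intro degree_le_sum degree_le_scale degree_le.monomial) auto
  ultimately show ?thesis by metis
qed

text \<open>The binomial coefficient counts the \<open>k\<close>-subsets of \<open>X\<close> inside
  \<open>I\<close>, each contributing a monomial of size \<open>k\<close>.\<close>

lemma degree_le_choose:
  assumes "finite X"
  shows "degree_le k (\<lambda>I. int (card (I \<inter> X) choose k))"
proof -
  let ?S = "{A. A \<subseteq> X \<and> card A = k}"
  have fin: "finite ?S" using assms by simp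
  have "int (card (I \<inter> X) choose k) = (\<Sum>A\<in>?S. of_bool (A \<subseteq> I))" for I
  proof -
    have "?S \<inter> {A. A \<subseteq> I} = {A. A \<subseteq> I \<inter> X \<and> card A = k}" by auto
    then have "card (?S \<inter> {A. A \<subseteq> I}) = card (I \<inter> X) choose k"
      using assms n_subsets[of "I \<inter> X" k] by simp
    then show ?thesis using fin by simp
  qed
  moreover have "degree_le k (\<lambda>I. \<Sum>A\<in>?S. of_bool (A \<subseteq> I))"
    using assms by (intro degree_le_sum degree_le.monomial) (auto intro: finite_subset)
  ultimately show ?thesis by simp
qed

text \<open>Some \<open>x\<close> in \<open>X\<close> lies outside \<open>A\<close>. Inserting
  \<open>x\<close> pairs up the subsets of \<open>X\<close>, flips the sign and does not affect
  whether \<open>A\<close> is contained, so the pairs cancel.\<close>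

lemma signed_sum_supersets:
  assumes "finite X" "card A < card X" "finite A"
  shows "(\<Sum>I\<in>Pow X. (-1) ^ card I * (of_bool (A \<subseteq> I) :: int)) = 0"
proof -
  obtain x where x: "x \<in> X" "x \<notin> A"
    using assms by (metis card_mono not_le subsetI)
  define Y where "Y = X - {x}"
  have X: "X = insert x Y" "x \<notin> Y" "finite Y" using x assms by (auto simp: Y_def)
  have inj: "inj_on (insert x) (Pow Y)" using X by (auto simp: inj_on_def)
  have disj: "Pow Y \<inter> insert x ` Pow Y = {}" using X by auto
  have eq: "(-1) ^ card (insert x I) * (of_bool (A \<subseteq> insert x I) :: int)
      = - ((-1) ^ card I * of_bool (A \<subseteq> I))" if "I \<in> Pow Y" for I
  proof -
    have "finite I" "x \<notin> I" using that X by (auto intro: finite_subset)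
    moreover have "A \<subseteq> insert x I \<longleftrightarrow> A \<subseteq> I" using x by auto
    ultimately show ?thesis by simp
  qed
  let ?f = "\<lambda>I. (-1) ^ card I * (of_bool (A \<subseteq> I) :: int)"
  have "sum ?f (insert x ` Pow Y) = - sum ?f (Pow Y)"
    unfolding sum.reindex[OF inj] o_def sum_negf[symmetric] using eq by (rule sum.cong[OF refl])
  then show ?thesis
    unfolding X(1) Pow_insert using X(3) disj
    by (subst sum.union_disjoint) auto
qed

lemma signed_sum_low_degree:
  assumes "degree_le d F" "finite X" "d < card X"
  shows "(\<Sum>I\<in>Pow X. (-1) ^ card I * F I) = 0"
  using assms(1)
proof (induction rule: degree_le.induct)
  case (monomial A)
  then show ?case using assms by (intro signed_sum_supersets) auto
next
  case zero
  show ?case by simp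
next
  case (add_scaled F G c)
  have "(\<Sum>I\<in>Pow X. (-1) ^ card I * (F I + c * G I))
      = (\<Sum>I\<in>Pow X. (-1) ^ card I * F I) + c * (\<Sum>I\<in>Pow X. (-1) ^ card I * G I)"
    by (simp add: sum.distrib sum_distrib_left algebra_simps)
  then show ?case using add_scaled.IH by simp
qed

section \<open>Zero-sum index sets modulo a prime\<close>

lemma fermat_indicator:
  fixes x :: int
  assumes "prime p"
  shows "[1 - x ^ (p - 1) = of_bool (int p dvd x)] (mod int p)"
proof -
  have p: "p > 1" using assms by (rule prime_gt_1_nat)
  define n where "n = nat (x mod int p)"
  have "int n = x mod int p" using p by (simp add: n_def)
  then have xn: "[x = int n] (mod int p)" by (simp add: cong_def)
  then have dvd: "int p dvd x \<longleftrightarrow> p dvd n" by (metis cong_dvd_iff int_dvd_int_iff)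
  have pow: "[x ^ (p - 1) = int n ^ (p - 1)] (mod int p)" using xn by (rule cong_pow)
  show ?thesis
  proof (cases "p dvd n")
    case True
    \<comment> \<open>Here \<open>p > 1\<close> makes the exponent positive.\<close>
    then have "int p dvd x ^ (p - 1)" using dvd p by (auto intro: dvd_trans dvd_power)
    then show ?thesis using True dvd by (simp add: cong_iff_dvd_diff)
  next
    case False
    then have "[n ^ (p - 1) = 1] (mod p)" by (rule fermat_theorem[OF assms])
    then have "[int n ^ (p - 1) = 1] (mod int p)" by (metis cong_int_iff of_nat_1 of_nat_power)
    then have "[x ^ (p - 1) = 1] (mod int p)" using pow by (rule cong_trans[rotated])
    then have "[1 - x ^ (p - 1) = 1 - 1] (mod int p)" by (intro cong_diff cong_refl)
    then show ?thesis using False dvd by simp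
  qed
qed

context
  fixes p :: nat and a b :: "'i \<Rightarrow> int"
begin

text \<open>\<open>a\<close> and \<open>b\<close> are integer lifts of the two coordinates. The size
  condition is a third sum, with constant weight \<open>1\<close>, so the same indicator polynomial
  treats all three.\<close>

definition zero_sum_set :: "'i set \<Rightarrow> bool" where
  "zero_sum_set I \<longleftrightarrow> p dvd card I \<and> int p dvd (\<Sum>i\<in>I. a i) \<and> int p dvd (\<Sum>i\<in>I. b i)"

text \<open>Each of the three conditions costs degree \<open>p - 1\<close> by
  \<open>fermat_indicator\<close>; the weight \<open>H\<close> can be chosen to suppress unwanted
  sizes.\<close>

lemma signed_sum_zero_sum_sets:
  assumes p: "prime p" and X: "finite X" and H: "degree_le d H"
    and d: "3 * (p - 1) + d < card X"
  shows "int p dvd (\<Sum>I | I \<subseteq> X \<and> zero_sum_set I. (-1) ^ card I * H I)"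
proof -
  define E :: "('i \<Rightarrow> int) \<Rightarrow> 'i set \<Rightarrow> int" where
    "E c I = 1 - (\<Sum>i\<in>I \<inter> X. c i) ^ (p - 1)" for c I
  have E: "degree_le (p - 1) (E c)" for c
    using degree_le_diff[OF degree_le_const degree_le_power[OF degree_le_linear[OF X, of c], of "p - 1"]]
    unfolding E_def by simp
  define F where "F I = E a I * (E b I * (E (\<lambda>_. 1) I * H I))" for I
  have "degree_le ((p - 1) + ((p - 1) + ((p - 1) + d))) F"
    unfolding F_def by (intro degree_le_mult E H)
  then have 0: "(\<Sum>I\<in>Pow X. (-1) ^ card I * F I) = 0"
    by (rule signed_sum_low_degree) (use X d in auto)
  have "[(\<Sum>I\<in>Pow X. (-1) ^ card I * F I)
      = (\<Sum>I\<in>Pow X. (-1) ^ card I * (of_bool (zero_sum_set I) * H I))] (mod int p)"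
  proof (intro cong_sum cong_mult cong_refl)
    fix I assume "I \<in> Pow X"
    then have I: "I \<inter> X = I" by auto
    have cd: "[E c I = of_bool (int p dvd (\<Sum>i\<in>I. c i))] (mod int p)" for c
      unfolding E_def I by (rule fermat_indicator[OF p])
    have "[F I = of_bool (int p dvd (\<Sum>i\<in>I. a i)) * (of_bool (int p dvd (\<Sum>i\<in>I. b i))
        * (of_bool (int p dvd (\<Sum>i\<in>I. 1)) * H I))] (mod int p)"
      unfolding F_def by (intro cong_mult cd cong_refl)
    also have "of_bool (int p dvd (\<Sum>i\<in>I. a i)) * (of_bool (int p dvd (\<Sum>i\<in>I. b i))
        * (of_bool (int p dvd (\<Sum>i\<in>I. 1)) * H I)) = of_bool (zero_sum_set I) * H I"
      by (auto simp: zero_sum_set_def)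
    finally show "[F I = of_bool (zero_sum_set I) * H I] (mod int p)" .
  qed
  moreover have "(\<Sum>I\<in>Pow X. (-1) ^ card I * (of_bool (zero_sum_set I) * H I))
      = (\<Sum>I | I \<subseteq> X \<and> zero_sum_set I. (-1) ^ card I * H I)"
    using X by (intro sum.mono_neutral_cong_right) auto
  ultimately show ?thesis using 0 by (metis cong_dvd_iff dvd_0_right)
qed

lemma zero_sum_set_Diff:
  assumes "zero_sum_set J" "zero_sum_set I" "I \<subseteq> J" "finite J"
  shows "zero_sum_set (J - I)"
  using assms finite_subset[OF assms(3,4)]
  by (auto simp: zero_sum_set_def sum_diff card_Diff_subset)

lemma zero_sum_set_Un:
  assumes "zero_sum_set J" "zero_sum_set I" "I \<inter> J = {}" "finite J" "finite I"
  shows "zero_sum_set (I \<union> J)"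
  using assms by (auto simp: zero_sum_set_def sum.union_disjoint card_Un_disjoint)

lemma zero_sum_set_p_or_2p:
  assumes p: "prime p" and X: "finite X" "card X \<ge> 3 * p - 2"
  obtains I where "I \<subseteq> X" "zero_sum_set I" "card I = p \<or> card I = 2 * p"
proof -
  have p2: "p \<ge> 2" using p by (rule prime_ge_2_nat)
  \<comment> \<open>This size just exceeds the degree \<open>3 * (p - 1)\<close>, yet stays below
    \<open>3 * p\<close>, which excludes sizes beyond \<open>2 * p\<close>.\<close>
  obtain Y where Y: "Y \<subseteq> X" "card Y = 3 * p - 2" "finite Y"
    using X by (metis obtain_subset_with_card_n)
  have sum: "int p dvd (\<Sum>I | I \<subseteq> Y \<and> zero_sum_set I. (-1) ^ card I * 1)"
    by (rule signed_sum_zero_sum_sets[OF p Y(3) degree_le_const[of 0]]) (use p2 Y in auto)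
  have "\<exists>I. I \<subseteq> Y \<and> zero_sum_set I \<and> I \<noteq> {}"
  proof (rule ccontr)
    assume "\<not> ?thesis"
    \<comment> \<open>The empty set alone would contribute \<open>1\<close>, which \<open>p\<close>
      does not divide.\<close>
    then have "{I. I \<subseteq> Y \<and> zero_sum_set I} = {{}}" by (auto simp: zero_sum_set_def)
    with sum p2 show False by simp
  qed
  then obtain I where I: "I \<subseteq> Y" "zero_sum_set I" "I \<noteq> {}" by blast
  then obtain k where k: "card I = p * k" by (auto simp: zero_sum_set_def)
  have "card I \<le> 3 * p - 2" using I Y by (metis card_mono)
  then have "p * k < p * 3" using k p2 by linarith
  then have "k < 3" by simp
  moreover have "k \<noteq> 0" using k I Y by (auto simp: finite_subset)
  ultimately have "k = 1 \<or> k = 2" by auto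
  then have "card I = p \<or> card I = 2 * p" using k by auto
  then show thesis using that I(1,2) Y(1) by blast
qed

text \<open>By Vandermonde's identity this is the sum of the squares of \<open>p choose k\<close>;
  modulo \<open>p\<close> only \<open>k = 0\<close> and \<open>k = p\<close> survive, contributing
  \<open>1\<close> each.\<close>

lemma central_choose_prime:
  assumes "prime p"
  shows "[int (2 * p choose p) = 2] (mod int p)"
proof -
  have p: "p > 1" using assms by (rule prime_gt_1_nat)
  have "{..p} = insert 0 (insert p {1..<p})" using p by auto
  then have "(2 * p choose p) = 2 + (\<Sum>k\<in>{1..<p}. (p choose k)^2)"
    using p by (simp flip: choose_square_sum)
  moreover have "p dvd (\<Sum>k\<in>{1..<p}. (p choose k)^2)"
  proof (rule dvd_sum)
    fix k assume "k \<in> {1..<p}"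
    then have "p dvd (p choose k)"
      using assms by (intro dvd_choose_prime) auto
    then show "p dvd (p choose k)^2" by (simp add: power2_eq_square)
  qed
  ultimately show ?thesis
    by (simp add: cong_iff_dvd_diff flip: of_nat_power of_nat_sum)
qed

lemma zero_sum_set_p:
  assumes p: "prime p" and X: "finite X" "card X \<ge> 4 * p - 2"
  obtains I where "I \<subseteq> X" "zero_sum_set I" "card I = p"
proof (cases "p = 2")
  case True
  \<comment> \<open>For \<open>p = 2\<close> the weight argument would only yield
    \<open>2 dvd 2\<close>. Instead, at least six indices share four parity patterns, and two with
    the same pattern form the set.\<close>
  define f where "f i = (even (a i), even (b i))" for i
  have "\<not> inj_on f X"
  proof
    assume "inj_on f X"
    then have "card X \<le> card (UNIV :: (bool \<times> bool) set)"
      by (rule card_inj_on_le) auto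
    also have "\<dots> = 4"
      by (simp add: UNIV_Times_UNIV[symmetric] card_cartesian_product del: UNIV_Times_UNIV)
    finally show False using X True by simp
  qed
  then obtain i j where "i \<in> X" "j \<in> X" "i \<noteq> j" "f i = f j" by (auto simp: inj_on_def)
  moreover from this have "zero_sum_set {i, j}"
    using True unfolding zero_sum_set_def by (auto simp: f_def)
  ultimately show ?thesis using True by (intro that[of "{i, j}"]) auto
next
  case False
  have p2: "p > 2" using p False prime_ge_2_nat[OF p] by linarith
  \<comment> \<open>This size exceeds the degree \<open>3 * (p - 1) + p\<close> by one and excludes
    zero-sum sets of size \<open>4 * p\<close>.\<close>
  obtain Y where Y: "Y \<subseteq> X" "card Y = 4 * p - 2" "finite Y"
    using X by (metis obtain_subset_with_card_n)
  note found = that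
  show ?thesis
  proof (rule ccontr)
    assume "\<not> thesis"
    then have none: "card I \<noteq> p" if "I \<subseteq> Y" "zero_sum_set I" for I
      using that Y found by blast
    have none3: "card J \<noteq> 3 * p" if J: "J \<subseteq> Y" "zero_sum_set J" for J
    proof
      assume 3: "card J = 3 * p"
      have fin: "finite J" using J Y by (auto intro: finite_subset)
      obtain I where I: "I \<subseteq> J" "zero_sum_set I" "card I = p \<or> card I = 2 * p"
        using zero_sum_set_p_or_2p[OF p fin] 3 by auto
      then have "card I = 2 * p" using none J by auto
      then have "card (J - I) = p" using I fin 3 by (simp add: card_Diff_subset finite_subset)
      moreover have "zero_sum_set (J - I)" by (rule zero_sum_set_Diff) (use I J fin in auto)
      ultimately show False using none J by blast
    qed
    \<comment> \<open>Modulo \<open>p\<close>, the weight \<open>H\<close> vanishes on sets of size \<open>2 p\<close>, which leaves only the empty set.\<close>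
    define H :: "'i set \<Rightarrow> int" where "H I = int (card (I \<inter> Y) choose p) - 2" for I
    have "degree_le p H"
      unfolding H_def by (intro degree_le_diff degree_le_choose degree_le_const Y)
    then have dvd: "int p dvd (\<Sum>I | I \<subseteq> Y \<and> zero_sum_set I. (-1) ^ card I * H I)"
      by (rule signed_sum_zero_sum_sets[OF p Y(3)]) (use p2 Y in auto)
    have H: "int p dvd (-1) ^ card I * H I" if I: "I \<subseteq> Y" "zero_sum_set I" "I \<noteq> {}" for I
    proof -
      obtain k where k: "card I = p * k" using I by (auto simp: zero_sum_set_def)
      have "card I \<le> 4 * p - 2" using I Y by (metis card_mono)
      then have "p * k < p * 4" using k p2 by linarith
      then have "k < 4" by simp
      moreover have "k \<noteq> 0" using k I Y by (auto simp: finite_subset)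
      moreover have "k \<noteq> 1" "k \<noteq> 3" using none[OF I(1,2)] none3[OF I(1,2)] k by auto
      ultimately have "card I = 2 * p" using k by (simp add: numeral_eq_Suc less_Suc_eq)
      moreover have "I \<inter> Y = I" using I by auto
      ultimately show ?thesis
        using central_choose_prime[OF p] by (simp add: H_def cong_iff_dvd_diff)
    qed
    let ?Z = "{I. I \<subseteq> Y \<and> zero_sum_set I}"
    have Z: "finite ?Z" "{} \<in> ?Z" using Y by (auto simp: zero_sum_set_def)
    have "int p dvd (\<Sum>I\<in>?Z - {{}}. (-1) ^ card I * H I)"
      by (rule dvd_sum) (use H in auto)
    with dvd have "int p dvd (-1) ^ card ({} :: 'i set) * H {}"
      by (simp add: sum.remove[OF Z] dvd_add_left_iff)
    \<comment> \<open>\<open>H {}\<close> is \<open>-2\<close> because \<open>0 choose p\<close> is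
      \<open>0\<close>.\<close>
    then have "int p dvd 2" using p2 by (simp add: H_def binomial_eq_0)
    then show False using p2 zdvd_imp_le by fastforce
  qed
qed

text \<open>The induction cannot start at \<open>t = 1\<close>: \<open>p - 1\<close> copies of each
  of (0,0), (1,0), (0,1), (1,1) contain no zero-sum set of size \<open>p\<close>, although there are
  at least \<open>3 * p - 2\<close> of them.\<close>

lemma zero_sum_set_multiple_p:
  assumes p: "prime p" and "t \<ge> 2" "finite X" "card X \<ge> (t + 2) * p - 2"
  shows "\<exists>I\<subseteq>X. zero_sum_set I \<and> card I = t * p"
  using assms(2-)
proof (induction t arbitrary: X rule: nat_induct_at_least)
  case base
  have "card X \<ge> 3 * p - 2" using base by simp
  then obtain I where I: "I \<subseteq> X" "zero_sum_set I" "card I = p \<or> card I = 2 * p"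
    using zero_sum_set_p_or_2p[OF p base(1)] by metis
  show ?case
  proof (cases "card I = p")
    case True
    have fin: "finite I" using I base by (auto intro: finite_subset)
    have "card (X - I) \<ge> 3 * p - 2" using base I True fin by (simp add: card_Diff_subset)
    then obtain J where J: "J \<subseteq> X - I" "zero_sum_set J" "card J = p \<or> card J = 2 * p"
      using zero_sum_set_p_or_2p[OF p finite_Diff[OF base(1)]] by metis
    have finJ: "finite J" using J base by (auto intro: finite_subset)
    have IJ: "I \<inter> J = {}" using J by auto
    have "zero_sum_set (I \<union> J)" "card (I \<union> J) = card I + card J"
      by (rule zero_sum_set_Un[OF J(2) I(2) IJ finJ fin] card_Un_disjoint[OF fin finJ IJ])+
    \<comment> \<open>If \<open>J\<close> has size \<open>2 * p\<close> it serves alone; otherwise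
      \<open>I \<union> J\<close> does.\<close>
    then show ?thesis using I J True by (metis Diff_subset Un_least mult_2 subset_trans)
  qed (use I in auto)
next
  case (Suc t)
  have "4 * p - 2 \<le> (Suc t + 2) * p - 2"
    using Suc.hyps by (intro diff_le_mono mult_le_mono1) simp
  then have "4 * p - 2 \<le> card X" using Suc.prems(2) by (rule order_trans)
  then obtain I where I: "I \<subseteq> X" "zero_sum_set I" "card I = p"
    using zero_sum_set_p[OF p Suc.prems(1)] by metis
  have fin: "finite I" using I Suc.prems by (auto intro: finite_subset)
  have "card (X - I) \<ge> (t + 2) * p - 2"
    using Suc.prems I fin by (simp add: card_Diff_subset)
  then obtain J where J: "J \<subseteq> X - I" "zero_sum_set J" "card J = t * p"
    using Suc.IH[OF finite_Diff[OF Suc.prems(1)]] by metis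
  have finJ: "finite J" using J Suc.prems by (auto intro: finite_subset)
  have IJ: "I \<inter> J = {}" using J by auto
  have "zero_sum_set (I \<union> J)" by (rule zero_sum_set_Un[OF J(2) I(2) IJ finJ fin])
  moreover have "card (I \<union> J) = Suc t * p"
    using I J by (simp add: card_Un_disjoint[OF fin finJ IJ])
  ultimately show ?case using I J by blast
qed

end

section \<open>From index sets to sequences in the group\<close>

lemma finprod_integer_mod_group_square:
  assumes "finite A"
    and "\<And>i. i \<in> A \<Longrightarrow> f i \<in> carrier (integer_mod_group p \<times>\<times> integer_mod_group p)"
  shows "finprod (integer_mod_group p \<times>\<times> integer_mod_group p) f A
    = ((\<Sum>i\<in>A. fst (f i)) mod int p, (\<Sum>i\<in>A. snd (f i)) mod int p)"
proof -
  interpret G: comm_group "integer_mod_group p \<times>\<times> integer_mod_group p"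
    by (rule comm_group_integer_mod_group_square)
  show ?thesis
    using assms
  proof (induction A rule: finite_induct)
    case empty
    show ?case by simp
  next
    case (insert x A)
    then have "finprod (integer_mod_group p \<times>\<times> integer_mod_group p) f (insert x A)
      = f x \<otimes>\<^bsub>integer_mod_group p \<times>\<times> integer_mod_group p\<^esub>
        finprod (integer_mod_group p \<times>\<times> integer_mod_group p) f A"
      by (intro G.finprod_insert) auto
    with insert show ?case
      by (cases "f x") (simp add: mod_add_right_eq)
  qed
qed

lemma zero_sum_integer_mod_group_square:
  assumes "set ys \<subseteq> carrier (integer_mod_group p \<times>\<times> integer_mod_group p)"
  shows "zero_sum (integer_mod_group p \<times>\<times> integer_mod_group p) ys
    \<longleftrightarrow> int p dvd sum_list (map fst ys) \<and> int p dvd sum_list (map snd ys)"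
proof -
  have "ys ! i \<in> carrier (integer_mod_group p \<times>\<times> integer_mod_group p)"
    if "i \<in> {..<length ys}" for i
    using assms that by (meson lessThan_iff nth_mem subsetD)
  then have "(\<Otimes>\<^bsub>integer_mod_group p \<times>\<times> integer_mod_group p\<^esub>i\<in>{..<length ys}. ys ! i)
    = ((\<Sum>i<length ys. fst (ys ! i)) mod int p, (\<Sum>i<length ys. snd (ys ! i)) mod int p)"
    by (rule finprod_integer_mod_group_square[OF finite_lessThan])
  then show ?thesis
    by (simp add: zero_sum_def sum_list_sum_nth dvd_eq_mod_eq_0 atLeast0LessThan)
qed

text \<open>Induction from the right leaves earlier positions unshifted. The intersection discards
  positions of \<open>I\<close> beyond the list.\<close>

lemma sum_list_map_nths:
  fixes g :: "'a \<Rightarrow> 'b :: comm_monoid_add"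
  shows "sum_list (map g (nths xs I)) = (\<Sum>i\<in>I \<inter> {..<length xs}. g (xs ! i))"
proof (induction xs rule: rev_induct)
  case Nil
  show ?case by simp
next
  case (snoc x xs)
  have "(\<Sum>i\<in>I \<inter> {..<length xs}. g ((xs @ [x]) ! i)) = (\<Sum>i\<in>I \<inter> {..<length xs}. g (xs ! i))"
    by (intro sum.cong) (auto simp: nth_append)
  with snoc show ?case
    by (auto simp: nths_append lessThan_Suc Int_insert_right add.commute)
qed

lemma egz_square_upper:
  assumes p: "prime p" and t: "t \<ge> 2"
    and xs: "set xs \<subseteq> carrier (integer_mod_group p \<times>\<times> integer_mod_group p)"
      "length xs = (t + 2) * p - 2"
  shows "\<exists>ys. subseq ys xs \<and> length ys = p * t
    \<and> zero_sum (integer_mod_group p \<times>\<times> integer_mod_group p) ys"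
proof -
  \<comment> \<open>Indices are positions in \<open>xs\<close>, so equal terms count
    separately.\<close>
  obtain I where I: "I \<subseteq> {..<length xs}" "card I = t * p"
      "zero_sum_set p (\<lambda>i. fst (xs ! i)) (\<lambda>i. snd (xs ! i)) I"
    using zero_sum_set_multiple_p[OF p t, of "{..<length xs}" "\<lambda>i. fst (xs ! i)" "\<lambda>i. snd (xs ! i)"] xs
    by auto
  define ys where "ys = nths xs I"
  have II: "I \<inter> {..<length xs} = I" using I by auto
  then have "{i. i < length xs \<and> i \<in> I} = I" by auto
  then have "length ys = p * t" using I by (simp add: ys_def length_nths)
  moreover have "subseq ys xs" unfolding ys_def subseq_conv_nths by blast
  moreover have "set ys \<subseteq> carrier (integer_mod_group p \<times>\<times> integer_mod_group p)"
    unfolding ys_def by (rule subset_trans[OF set_nths_subset xs(1)])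
  then have "zero_sum (integer_mod_group p \<times>\<times> integer_mod_group p) ys"
    using I(3)
    by (simp add: zero_sum_integer_mod_group_square ys_def sum_list_map_nths II zero_sum_set_def)
  ultimately show ?thesis by blast
qed

section \<open>The extremal sequence for the lower bound\<close>

lemma subseq_replicateE:
  assumes "subseq ys (replicate n x)"
  obtains m where "m \<le> n" "ys = replicate m x"
proof -
  have "set ys \<subseteq> {x}"
    using assms set_nths_subset by (fastforce simp: subseq_conv_nths)
  then have "ys = replicate (length ys) x"
    by (intro replicate_eqI) auto
  moreover have "length ys \<le> n"
    using list_emb_length[OF assms] by simp
  ultimately show thesis using that by metis
qed

text \<open>Minimality needs a counterexample at every smaller length; prefixes of one longest
  counterexample supply them.\<close>

lemma egz_square_lower:
  assumes p: "p > 1" and t: "t > 0" and l: "l < (t + 2) * p - 2"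
  shows "\<exists>xs. set xs \<subseteq> carrier (integer_mod_group p \<times>\<times> integer_mod_group p) \<and> length xs = l
    \<and> \<not> (\<exists>ys. subseq ys xs \<and> length ys = p * t
        \<and> zero_sum (integer_mod_group p \<times>\<times> integer_mod_group p) ys)"
proof -
  let ?G = "integer_mod_group p \<times>\<times> integer_mod_group p"
  define zs :: "(int \<times> int) list" where
    "zs = replicate (p * t - 1) (0, 0) @ replicate (p - 1) (1, 0) @ replicate (p - 1) (0, 1)"
  have zs: "set zs \<subseteq> carrier ?G"
    using p by (auto simp: zs_def)
  have pt: "p * t \<ge> 1" using p t by (simp add: Suc_leI)
  \<comment> \<open>\<open>zs\<close> has length \<open>(t + 2) * p - 3\<close>, the largest
    admissible \<open>l\<close>; \<open>pt\<close> keeps the subtraction from truncating.\<close>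
  have "l \<le> length zs" using l p pt by (simp add: zs_def algebra_simps)
  then have len: "length (take l zs) = l" by simp
  have False if ys: "subseq ys (take l zs)" "length ys = p * t" "zero_sum ?G ys" for ys
  proof -
    have sub: "subseq ys zs"
      using ys(1) by (meson prefix_imp_subseq subseq_order.order_trans take_is_prefix)
    then obtain us vs ws where uvw: "ys = us @ vs @ ws"
        "subseq us (replicate (p * t - 1) (0, 0))" "subseq vs (replicate (p - 1) (1, 0))"
        "subseq ws (replicate (p - 1) (0, 1))"
      unfolding zs_def by (elim subseq_appendE) blast
    obtain k where k: "k \<le> p * t - 1" "us = replicate k (0, 0)"
      using uvw(2) by (rule subseq_replicateE)
    obtain m where m: "m \<le> p - 1" "vs = replicate m (1, 0)"
      using uvw(3) by (rule subseq_replicateE)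
    obtain n where n: "n \<le> p - 1" "ws = replicate n (0, 1)"
      using uvw(4) by (rule subseq_replicateE)
    have eq: "ys = replicate k (0, 0) @ replicate m (1, 0) @ replicate n (0, 1)"
      by (simp add: uvw(1) k m n)
    have "set ys \<subseteq> carrier ?G"
      using sub zs set_nths_subset by (fastforce simp: subseq_conv_nths)
    \<comment> \<open>The coordinate sums of \<open>ys\<close> are \<open>m\<close> and
      \<open>n\<close>, both below \<open>p\<close>, so both must vanish. Only copies of (0,0)
      remain, and there are too few.\<close>
    then have "int p dvd int m" "int p dvd int n"
      using ys(3) p by (auto simp: zero_sum_integer_mod_group_square eq sum_list_replicate)
    then have "m = 0" "n = 0" using m n p by (auto dest: dvd_imp_le)
    then have "k = p * t" using ys(2) by (simp add: eq)
    then show False using k(1) pt by linarith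
  qed
  moreover have "set (take l zs) \<subseteq> carrier ?G" using zs set_take_subset by fast
  ultimately show ?thesis using len by blast
qed

theorem theorem1p12:
  fixes p t :: nat
  assumes "prime p" and "t \<ge> 2"
  shows "egz_const (p * t) (integer_mod_group p \<times>\<times> integer_mod_group p) = (t + 2) * p - 2"
  unfolding egz_const_def
proof (rule Least_equality)
  show "\<forall>xs. set xs \<subseteq> carrier (integer_mod_group p \<times>\<times> integer_mod_group p)
      \<and> length xs = (t + 2) * p - 2 \<longrightarrow>
    (\<exists>ys. subseq ys xs \<and> length ys = p * t
      \<and> zero_sum (integer_mod_group p \<times>\<times> integer_mod_group p) ys)"
    using egz_square_upper[OF assms] by blast
next
  fix l
  assume "\<forall>xs. set xs \<subseteq> carrier (integer_mod_group p \<times>\<times> integer_mod_group p) \<and> length xs = l \<longrightarrow>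
    (\<exists>ys. subseq ys xs \<and> length ys = p * t
      \<and> zero_sum (integer_mod_group p \<times>\<times> integer_mod_group p) ys)"
  moreover have "t > 0" using assms(2) by simp
  ultimately show "(t + 2) * p - 2 \<le> l"
    using egz_square_lower[of p t l] prime_gt_1_nat[OF assms(1)] by (meson not_le)
qed

end
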